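(* Let $\mathcal{R}_1$ be a reference structure from a set $S_1$ to a set $O_1$ and $\mathcal{R}_2$ a reference structure from a set $S_2$ to a set $O_2$, with costs $c_{\mathcal{R}_i}:S_i\times O_i\to\mathbb{R}_{\ge0}$, and let $\mathcal{R}_1\otimes\mathcal{R}_2$ be their product. Then for all $(s_1,s_2)\in S_1\times S_2$ and $(o_1,o_2)\in O_1\times O_2$, $(o_1,o_2)$ is a meaning of $(s_1,s_2)$ under $\mathcal{R}_1\otimes\mathcal{R}_2$ if and only if $o_1$ is a meaning of $s_1$ under $\mathcal{R}_1$ and $o_2$ is a meaning of $s_2$ under $\mathcal{R}_2$. Equivalently, $$\mathrm{Mean}_{\mathcal{R}_1\otimes\mathcal{R}_2}(s_1,s_2)=\mathrm{Mean}_{\mathcal{R}_1}(s_1)\times\mathrm{Mean}_{\mathcal{R}_2}(s_2).$$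
   Context: A reference structure $\mathcal{R}$ from a set $S$ to a set $O$ is an arbitrary function $c_{\mathcal{R}}:S\times O\to\mathbb{R}_{\ge0}$ (the reference cost). The meaning set of $s\in S$ is $\mathrm{Mean}_{\mathcal{R}}(s):=\{o\in O:\ c_{\mathcal{R}}(s,o)\le c_{\mathcal{R}}(s,o')\ \text{for all } o'\in O\}$; its elements are the meanings of $s$. The product reference structure $\mathcal{R}_1\otimes\mathcal{R}_2$ from $S_1\times S_2$ to $O_1\times O_2$ has cost $c_{\mathcal{R}_1\otimes\mathcal{R}_2}((s_1,s_2),(o_1,o_2)):=c_{\mathcal{R}_1}(s_1,o_1)+c_{\mathcal{R}_2}(s_2,o_2)$. *)

theory Defs
  imports Complex_Main
begin

(* Values of cost outside sources R \<times> objects R are unconstrained and never used. *)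
record ('s, 'o) ref_struct =
  sources :: "'s set"
  objects :: "'o set"
  cost :: "'s \<times> 'o \<Rightarrow> real"

definition reference_structure :: "('s, 'o) ref_struct \<Rightarrow> 's set \<Rightarrow> 'o set \<Rightarrow> bool" where
  "reference_structure R S T \<longleftrightarrow>
     sources R = S \<and> objects R = T \<and> (\<forall>s\<in>S. \<forall>t\<in>T. 0 \<le> cost R (s, t))"

definition Mean :: "('s, 'o) ref_struct \<Rightarrow> 's \<Rightarrow> 'o set" where
  "Mean R s = {t \<in> objects R. \<forall>t'\<in>objects R. cost R (s, t) \<le> cost R (s, t')}"

definition prod_ref ::
  "('s1, 'o1) ref_struct \<Rightarrow> ('s2, 'o2) ref_struct \<Rightarrow> ('s1 \<times> 's2, 'o1 \<times> 'o2) ref_struct"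
  (infixr "\<otimes>" 70) where
  "R1 \<otimes> R2 =
     \<lparr> sources = sources R1 \<times> sources R2,
       objects = objects R1 \<times> objects R2,
       cost = (\<lambda>((s1, s2), (t1, t2)). cost R1 (s1, t1) + cost R2 (s2, t2)) \<rparr>"

lemma reference_structure_prod_ref:
  assumes "reference_structure R1 S1 T1" and "reference_structure R2 S2 T2"
  shows "reference_structure (R1 \<otimes> R2) (S1 \<times> S2) (T1 \<times> T2)"
  using assms by (auto simp: reference_structure_def prod_ref_def)

end

theory Submission
  imports Defs
begin

text \<open>The product cost is a sum of two terms, each depending on one coordinate, and the
  competitors form a full Cartesian product, so minimisation decouples; \<open>Mean_prod_ref\<close>
  records this. Adding two coordinatewise minimality inequalities gives one inclusion. For the
  other, a competitor in one coordinate is paired with the minimiser's own other coordinate, which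
  is itself an admissible object.\<close>

lemma Mean_prod_ref: "Mean (R1 \<otimes> R2) (s1, s2) = Mean R1 s1 \<times> Mean R2 s2"
proof
  show "Mean R1 s1 \<times> Mean R2 s2 \<subseteq> Mean (R1 \<otimes> R2) (s1, s2)"
    by (auto simp: Mean_def prod_ref_def intro: add_mono)
  show "Mean (R1 \<otimes> R2) (s1, s2) \<subseteq> Mean R1 s1 \<times> Mean R2 s2"
  proof
    fix p assume "p \<in> Mean (R1 \<otimes> R2) (s1, s2)"
    then obtain t1 t2 where p: "p = (t1, t2)"
      and t: "t1 \<in> objects R1" "t2 \<in> objects R2"
      and le: "\<And>u1 u2. u1 \<in> objects R1 \<Longrightarrow> u2 \<in> objects R2 \<Longrightarrow>
        cost R1 (s1, t1) + cost R2 (s2, t2) \<le> cost R1 (s1, u1) + cost R2 (s2, u2)"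
      by (cases p) (auto simp: Mean_def prod_ref_def)
    \<comment> \<open>Varying one coordinate while keeping the other fixed lets the common summand cancel.\<close>
    show "p \<in> Mean R1 s1 \<times> Mean R2 s2"
      using t le[OF _ t(2)] le[OF t(1)] by (auto simp: p Mean_def)
  qed
qed

theorem theorem5p2:
  fixes R1 :: "('s1, 'o1) ref_struct" and R2 :: "('s2, 'o2) ref_struct"
    and S1 :: "'s1 set" and O1 :: "'o1 set" and S2 :: "'s2 set" and O2 :: "'o2 set"
  assumes "reference_structure R1 S1 O1"
    and "reference_structure R2 S2 O2"
  shows "(\<forall>s1\<in>S1. \<forall>s2\<in>S2. \<forall>o1\<in>O1. \<forall>o2\<in>O2.
            (o1, o2) \<in> Mean (R1 \<otimes> R2) (s1, s2) \<longleftrightarrow> o1 \<in> Mean R1 s1 \<and> o2 \<in> Mean R2 s2)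
       \<and> (\<forall>s1\<in>S1. \<forall>s2\<in>S2. Mean (R1 \<otimes> R2) (s1, s2) = Mean R1 s1 \<times> Mean R2 s2)"
  \<comment> \<open>The pointwise equivalence is the set equality read through membership of a pair
    in a Cartesian product.\<close>
  by (simp add: Mean_prod_ref)

end
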